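(* Let $(\Gamma,S)$ be a (one-sided) Sturmian subshift, let $\Delta$ be a finite set, let $m\ge 1$, and let $\psi^{*\infty}$ be the homomorphism from $(\Gamma,S)$ to $(\Delta^{\mathbb{N}},S)$ induced by a local rule $\psi:\mathcal{L}^m(\Gamma)\to\Delta$. If the rule $\psi$ is minimal and does not ignore the first letter, then the following conditions are equivalent: 1. $\psi^{*n}$ is injective for some positive integer $n$; 2. $\psi^{*\infty}$ is injective; 3. $\psi^{*\infty}$ is not constant; 4. $\psi$ is not constant.
   Context: $\mathbb{N}$ contains $0$; $S$ is the shift $(S(x))_i=x_{i+1}$ on one-sided infinite sequences. Sturmian subshift: let $\alpha\in(0,1)$ be irrational, $T(x)=(x+\alpha)\bmod 1$ on $[0,1)$, $P_0=[0,1-\alpha)$, $P_1=[1-\alpha,1)$, and $\Phi_{\mathcal{P}}:[0,1)\to\{0,1\}^{\mathbb{N}}$, where the $i$-th coordinate of $\Phi_{\mathcal{P}}(x)$ is $a$ iff $T^i(x)\in P_a$. Then $\Gamma=\overline{\Phi_{\mathcal{P}}([0,1))}$ (closure in the product topology). For $m\in\mathbb{N}$, $\mathcal{L}^m(\Gamma)$ is the set of words $x_kx_{k+1}\cdots x_{k+m-1}$ of length $m$ with $x\in\Gamma$, $k\in\mathbb{N}$. For a word $u$, $u[a,b)=u_au_{a+1}\cdots u_{b-1}$. A local rule of width $m\ge 1$ is a map $\psi:\mathcal{L}^m(\Gamma)\to\Delta$. For $n\geq 1$ it induces the sliding block code of length $n$, $\psi^{*n}:\mathcal{L}^{m+n-1}(\Gamma)\to\Delta^n$,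 $(\psi^{*n}(u))_i=\psi(u_iu_{i+1}\cdots u_{i+m-1})$ for $0\leq i<n$, and the infinite sliding block code $\psi^{*\infty}:\Gamma\to\Delta^{\mathbb{N}}$, $(\psi^{*\infty}(x))_i=\psi(x_ix_{i+1}\cdots x_{i+m-1})$ for $i\geq 0$. $\psi$ is minimal if either $m=1$, or there is no map $\psi':\mathcal{L}^{m-1}(\Gamma)\to\Delta$ with $\psi(u)=\psi'(u[0,m-1))$ for every $u\in\mathcal{L}^m(\Gamma)$. $\psi$ ignores the first letter if there is a map $\psi':\mathcal{L}^{m-1}(\Gamma)\to\Delta$ with $\psi(u)=\psi'(u[1,m))$ for every $u\in\mathcal{L}^m(\Gamma)$. *)

theory Defs
  imports "HOL-Analysis.Analysis"
begin

definition rotation :: "real \<Rightarrow> real \<Rightarrow> real" where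
  "rotation \<alpha> x = frac (x + \<alpha>)"

(* The orbit of a point of [0,1) stays in [0,1), so the else-branch is exactly membership in
   P_1 = [1 - \<alpha>, 1). *)
definition sturmian_coding :: "real \<Rightarrow> real \<Rightarrow> nat \<Rightarrow> nat" where
  "sturmian_coding \<alpha> x = (\<lambda>i. if (rotation \<alpha> ^^ i) x \<in> {0..<1 - \<alpha>} then 0 else 1)"

definition sturmian_subshift :: "real \<Rightarrow> (nat \<Rightarrow> nat) set" where
  "sturmian_subshift \<alpha> =
     product_topology (\<lambda>i::nat. discrete_topology {0, 1::nat}) UNIV
       closure_of (sturmian_coding \<alpha> ` {0..<1})"

definition language :: "nat \<Rightarrow> (nat \<Rightarrow> 'a) set \<Rightarrow> 'a list set" where
  "language m \<Gamma> = {map x [k..<k + m] | x k. x \<in> \<Gamma>}"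

definition slice :: "'a list \<Rightarrow> nat \<Rightarrow> nat \<Rightarrow> 'a list" where
  "slice u a b = take (b - a) (drop a u)"

(* A local rule is a function on all words; only its values on language m \<Gamma> are meaningful, and
   every notion below refers only to those. *)
definition local_rule :: "nat \<Rightarrow> (nat \<Rightarrow> 'a) set \<Rightarrow> 'd set \<Rightarrow> ('a list \<Rightarrow> 'd) \<Rightarrow> bool" where
  "local_rule m \<Gamma> \<Delta> \<psi> \<longleftrightarrow> \<psi> \<in> language m \<Gamma> \<rightarrow> \<Delta>"

(* The domain of the code of length n is language (m + n - 1) \<Gamma>. *)
definition block_code :: "nat \<Rightarrow> ('a list \<Rightarrow> 'd) \<Rightarrow> nat \<Rightarrow> 'a list \<Rightarrow> 'd list" where
  "block_code m \<psi> n u = map (\<lambda>i. \<psi> (slice u i (i + m))) [0..<n]"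

definition infinite_block_code :: "nat \<Rightarrow> ('a list \<Rightarrow> 'd) \<Rightarrow> (nat \<Rightarrow> 'a) \<Rightarrow> nat \<Rightarrow> 'd" where
  "infinite_block_code m \<psi> x = (\<lambda>i. \<psi> (map x [i..<i + m]))"

definition minimal_rule :: "nat \<Rightarrow> (nat \<Rightarrow> 'a) set \<Rightarrow> 'd set \<Rightarrow> ('a list \<Rightarrow> 'd) \<Rightarrow> bool" where
  "minimal_rule m \<Gamma> \<Delta> \<psi> \<longleftrightarrow>
     m = 1 \<or> \<not> (\<exists>\<psi>'. local_rule (m - 1) \<Gamma> \<Delta> \<psi>' \<and> (\<forall>u\<in>language m \<Gamma>. \<psi> u = \<psi>' (slice u 0 (m - 1))))"

definition ignores_first_letter :: "nat \<Rightarrow> (nat \<Rightarrow> 'a) set \<Rightarrow> 'd set \<Rightarrow> ('a list \<Rightarrow> 'd) \<Rightarrow> bool" where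
  "ignores_first_letter m \<Gamma> \<Delta> \<psi> \<longleftrightarrow>
     (\<exists>\<psi>'. local_rule (m - 1) \<Gamma> \<Delta> \<psi>' \<and> (\<forall>u\<in>language m \<Gamma>. \<psi> u = \<psi>' (slice u 1 m)))"

end

theory Submission
  imports Defs
begin

text \<open>
  Words of the language of \<open>\<Gamma>\<close> of length \<open>m\<close> are read off the floors of \<open>t + k\<alpha>\<close> for \<open>k \<le> m\<close>, so
  \<open>\<psi>\<close> becomes a step function \<open>f\<close> on the circle whose discontinuities lie among the points
  \<open>-k\<alpha>\<close> with \<open>k \<le> m\<close>. Since \<open>\<psi>\<close> does not ignore the first letter, \<open>0\<close> is a genuine
  discontinuity; since \<open>\<psi>\<close> is minimal, so is \<open>-m\<alpha>\<close>. Suppose \<open>f (x + i\<alpha>) = f (y + i\<alpha>)\<close> for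
  sufficiently many \<open>i\<close>. By density of the orbit, translation by \<open>y - x\<close> moves both discontinuities
  close to discontinuities, that is \<open>y - x \<approx> -k\<alpha>\<close> and \<open>y - x \<approx> (m - l)\<alpha>\<close> modulo \<open>1\<close> with
  \<open>k, l \<le> m\<close>; irrationality forces \<open>k = 0\<close>, so \<open>x\<close> and \<open>y\<close> are close. If a cut point \<open>-k\<alpha>\<close> separated
  them, some rotation by a multiple of \<open>\<alpha>\<close> would bring it to \<open>0\<close> or to \<open>-m\<alpha>\<close>, where \<open>f\<close> jumps.
  Hence \<open>\<psi>\<^sup>*\<^sup>n\<close> is injective for large \<open>n\<close>, and the hypotheses make all four conditions true.
\<close>

section \<open>Words of floor increments and their cut points\<close>

text \<open>Codes the orbit of \<open>t\<close> by floors instead of interval membership. As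
  \<open>t\<close> is any real, points can be compared by order without wrapping around the
  circle.\<close>

definition rotation_word :: "real \<Rightarrow> nat \<Rightarrow> real \<Rightarrow> nat list" where
  "rotation_word \<alpha> n t = map (\<lambda>i. nat (\<lfloor>t + real (Suc i) * \<alpha>\<rfloor> - \<lfloor>t + real i * \<alpha>\<rfloor>)) [0..<n]"

lemma length_rotation_word [simp]: "length (rotation_word \<alpha> n t) = n"
  by (simp add: rotation_word_def)

lemma nth_rotation_word:
  "i < n \<Longrightarrow> rotation_word \<alpha> n t ! i = nat (\<lfloor>t + real (Suc i) * \<alpha>\<rfloor> - \<lfloor>t + real i * \<alpha>\<rfloor>)"
  by (simp add: rotation_word_def)

lemma rotation_word_add_int: "rotation_word \<alpha> n (t + of_int p) = rotation_word \<alpha> n t"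
proof -
  have "\<lfloor>t + of_int p + real k * \<alpha>\<rfloor> = \<lfloor>t + real k * \<alpha>\<rfloor> + p" for k
    by (metis add.assoc add.commute floor_add_int)
  then show ?thesis
    unfolding rotation_word_def by (simp del: of_nat_Suc)
qed

lemma slice_rotation_word:
  assumes "a \<le> b" "b \<le> n"
  shows "slice (rotation_word \<alpha> n t) a b = rotation_word \<alpha> (b - a) (t + real a * \<alpha>)"
  using assms by (auto simp: slice_def nth_rotation_word algebra_simps intro!: nth_equalityI)

lemma rotation_word_cong:
  assumes "\<And>k. k \<le> n \<Longrightarrow> \<lfloor>s + real k * \<alpha>\<rfloor> = \<lfloor>t + real k * \<alpha>\<rfloor>"
  shows "rotation_word \<alpha> n s = rotation_word \<alpha> n t"
proof (rule nth_equalityI)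
  show "rotation_word \<alpha> n s ! i = rotation_word \<alpha> n t ! i" if "i < length (rotation_word \<alpha> n s)" for i
    using that assms[of i] assms[of "Suc i"] by (simp add: nth_rotation_word)
qed simp

lemma floor_neq_imp_int_between:
  fixes s t :: real
  assumes "s \<le> t" "\<lfloor>s\<rfloor> \<noteq> \<lfloor>t\<rfloor>"
  obtains q :: int where "s < of_int q" "of_int q \<le> t"
proof
  show "s < of_int \<lfloor>t\<rfloor>"
    using assms floor_mono[of s t] by linarith
qed linarith

lemma rotation_word_neq_imp_cut:
  assumes "s \<le> t" "rotation_word \<alpha> n s \<noteq> rotation_word \<alpha> n t"
  obtains k and q :: int where "k \<le> n" "s + real k * \<alpha> < of_int q" "of_int q \<le> t + real k * \<alpha>"
proof -
  obtain k where k: "k \<le> n" "\<lfloor>s + real k * \<alpha>\<rfloor> \<noteq> \<lfloor>t + real k * \<alpha>\<rfloor>"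
    using rotation_word_cong assms(2) by metis
  from floor_neq_imp_int_between[OF _ k(2)] assms(1) k(1) that show thesis
    by (metis add_le_cancel_right)
qed

text \<open>The points \<open>s\<close> and \<open>t\<close> lie on either side of the cut point \<open>-k\<alpha>\<close> and of no other one modulo \<open>1\<close>.\<close>

definition straddle :: "real \<Rightarrow> nat \<Rightarrow> nat \<Rightarrow> real \<Rightarrow> real \<Rightarrow> bool" where
  "straddle \<alpha> m k s t \<longleftrightarrow> \<lfloor>t + real k * \<alpha>\<rfloor> = \<lfloor>s + real k * \<alpha>\<rfloor> + 1 \<and>
     (\<forall>j\<le>m. j \<noteq> k \<longrightarrow> \<lfloor>s + real j * \<alpha>\<rfloor> = \<lfloor>t + real j * \<alpha>\<rfloor>)"

text \<open>The cut point \<open>q - k * \<alpha>\<close> lies above \<open>s\<close> and not above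
  \<open>t\<close>. For \<open>j \<noteq> k\<close> the floors at both ends agree, so by
  monotonicity they equal the floor at the cut point.\<close>

lemma straddle_floors:
  assumes st: "straddle \<alpha> m k s t"
  obtains q :: int where
    "\<And>j. j \<le> m \<Longrightarrow> \<lfloor>t + real j * \<alpha>\<rfloor> = q + \<lfloor>(real j - real k) * \<alpha>\<rfloor>"
    "\<And>j. j \<le> m \<Longrightarrow> \<lfloor>s + real j * \<alpha>\<rfloor> = q + \<lfloor>(real j - real k) * \<alpha>\<rfloor> - of_bool (j = k)"
proof -
  define q where "q = \<lfloor>t + real k * \<alpha>\<rfloor>"
  have sk: "\<lfloor>s + real k * \<alpha>\<rfloor> = q - 1"
    using st by (simp add: straddle_def q_def)
  have le: "s < of_int q - real k * \<alpha>" "of_int q - real k * \<alpha> \<le> t"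
    using sk unfolding q_def by linarith+
  have *: "\<lfloor>t + real j * \<alpha>\<rfloor> = q + \<lfloor>(real j - real k) * \<alpha>\<rfloor>
         \<and> \<lfloor>s + real j * \<alpha>\<rfloor> = q + \<lfloor>(real j - real k) * \<alpha>\<rfloor> - of_bool (j = k)" if "j \<le> m" for j
  proof (cases "j = k")
    case False
    have eq: "\<lfloor>s + real j * \<alpha>\<rfloor> = \<lfloor>t + real j * \<alpha>\<rfloor>"
      using False st that by (auto simp: straddle_def)
    have "of_int q - real k * \<alpha> + real j * \<alpha> = of_int q + (real j - real k) * \<alpha>"
      by (simp add: algebra_simps)
    then have "q + \<lfloor>(real j - real k) * \<alpha>\<rfloor> = \<lfloor>of_int q - real k * \<alpha> + real j * \<alpha>\<rfloor>"
      by (simp only: int_add_floor)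
    moreover have "\<lfloor>s + real j * \<alpha>\<rfloor> \<le> \<lfloor>of_int q - real k * \<alpha> + real j * \<alpha>\<rfloor>"
      using le by (intro floor_mono) simp
    moreover have "\<lfloor>of_int q - real k * \<alpha> + real j * \<alpha>\<rfloor> \<le> \<lfloor>t + real j * \<alpha>\<rfloor>"
      using le by (intro floor_mono) simp
    ultimately show ?thesis
      using eq False by simp
  qed (simp add: sk q_def)
  show thesis
    by (rule that[of q]) (use * in auto)
qed

text \<open>The floors of the two pairs differ by one common integer, which cancels in the
  increments. Hence one jump of the rule at a cut index forces a jump at every pair straddling that
  index.\<close>

lemma straddle_rotation_word:
  assumes "straddle \<alpha> m k s t" "straddle \<alpha> m k x y"
  shows "rotation_word \<alpha> m s = rotation_word \<alpha> m x" "rotation_word \<alpha> m t = rotation_word \<alpha> m y"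
proof -
  obtain q where q: "\<And>j. j \<le> m \<Longrightarrow> \<lfloor>t + real j * \<alpha>\<rfloor> = q + \<lfloor>(real j - real k) * \<alpha>\<rfloor>"
    "\<And>j. j \<le> m \<Longrightarrow> \<lfloor>s + real j * \<alpha>\<rfloor> = q + \<lfloor>(real j - real k) * \<alpha>\<rfloor> - of_bool (j = k)"
    using straddle_floors[OF assms(1)] by blast
  obtain p where p: "\<And>j. j \<le> m \<Longrightarrow> \<lfloor>y + real j * \<alpha>\<rfloor> = p + \<lfloor>(real j - real k) * \<alpha>\<rfloor>"
    "\<And>j. j \<le> m \<Longrightarrow> \<lfloor>x + real j * \<alpha>\<rfloor> = p + \<lfloor>(real j - real k) * \<alpha>\<rfloor> - of_bool (j = k)"
    using straddle_floors[OF assms(2)] by blast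
  show "rotation_word \<alpha> m s = rotation_word \<alpha> m x" "rotation_word \<alpha> m t = rotation_word \<alpha> m y"
    unfolding rotation_word_def using p q by (auto simp del: of_nat_Suc)
qed

section \<open>Coding by an irrational rotation and the language of the subshift\<close>

locale irrational_rotation =
  fixes \<alpha> :: real
  assumes pos: "0 < \<alpha>" and less_1: "\<alpha> < 1" and irrational: "\<alpha> \<notin> \<rat>"
begin

abbreviation W :: "nat \<Rightarrow> real \<Rightarrow> nat list" where "W \<equiv> rotation_word \<alpha>"

lemma floor_step: "\<lfloor>t + real (Suc i) * \<alpha>\<rfloor> - \<lfloor>t + real i * \<alpha>\<rfloor> \<in> {0, 1}"
proof -
  have "t + real (Suc i) * \<alpha> = (t + real i * \<alpha>) + \<alpha>"
    by (simp add: algebra_simps)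
  then show ?thesis
    using pos less_1 by simp linarith
qed

text \<open>Each increment is 0 or 1, so \<open>nat\<close> loses no information.\<close>

lemma rotation_word_eq_iff_steps:
  "W n x = W n y \<longleftrightarrow> (\<forall>i<n. \<lfloor>x + real (Suc i) * \<alpha>\<rfloor> - \<lfloor>x + real i * \<alpha>\<rfloor>
      = \<lfloor>y + real (Suc i) * \<alpha>\<rfloor> - \<lfloor>y + real i * \<alpha>\<rfloor>)"
proof -
  have "nat (\<lfloor>x + real (Suc i) * \<alpha>\<rfloor> - \<lfloor>x + real i * \<alpha>\<rfloor>)
      = nat (\<lfloor>y + real (Suc i) * \<alpha>\<rfloor> - \<lfloor>y + real i * \<alpha>\<rfloor>) \<longleftrightarrow>
      \<lfloor>x + real (Suc i) * \<alpha>\<rfloor> - \<lfloor>x + real i * \<alpha>\<rfloor>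
      = \<lfloor>y + real (Suc i) * \<alpha>\<rfloor> - \<lfloor>y + real i * \<alpha>\<rfloor>" for i
    using floor_step[of x i] floor_step[of y i] by auto
  then show ?thesis
    unfolding list_eq_iff_nth_eq by (simp add: nth_rotation_word del: of_nat_Suc)
qed

lemma rotation_word_eq_imp_floors:
  assumes "W n x = W n y" "\<lfloor>x\<rfloor> = \<lfloor>y\<rfloor>" "k \<le> n"
  shows "\<lfloor>x + real k * \<alpha>\<rfloor> = \<lfloor>y + real k * \<alpha>\<rfloor>"
  using assms(3)
proof (induction k)
  case (Suc k)
  moreover have "\<lfloor>x + real (Suc k) * \<alpha>\<rfloor> - \<lfloor>x + real k * \<alpha>\<rfloor>
      = \<lfloor>y + real (Suc k) * \<alpha>\<rfloor> - \<lfloor>y + real k * \<alpha>\<rfloor>"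
    using assms(1) Suc.prems unfolding rotation_word_eq_iff_steps by auto
  ultimately show ?case
    by simp
qed (use assms in simp)

lemma rotation_funpow:
  assumes "x \<in> {0..<1}"
  shows "(rotation \<alpha> ^^ i) x = frac (x + real i * \<alpha>)"
proof (induction i)
  case (Suc i)
  have "frac (frac (x + real i * \<alpha>) + \<alpha>) = frac (x + real i * \<alpha> + \<alpha>)"
    by (simp add: frac_def algebra_simps)
  then show ?case
    using Suc by (simp add: rotation_def algebra_simps)
qed (use assms in \<open>simp add: frac_eq\<close>)

text \<open>Adding \<alpha> carries past an integer exactly when the fractional part is at least
  \<open>1 - \<alpha>\<close>.\<close>

lemma sturmian_coding_eq:
  assumes "x \<in> {0..<1}"
  shows "sturmian_coding \<alpha> x i = nat (\<lfloor>x + real (Suc i) * \<alpha>\<rfloor> - \<lfloor>x + real i * \<alpha>\<rfloor>)"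
proof -
  define s where "s = x + real i * \<alpha>"
  have "sturmian_coding \<alpha> x i = (if frac s < 1 - \<alpha> then 0 else 1)"
    using rotation_funpow[OF assms] by (simp add: sturmian_coding_def s_def)
  also have "\<dots> = nat (\<lfloor>s + \<alpha>\<rfloor> - \<lfloor>s\<rfloor>)"
  proof (cases "frac s < 1 - \<alpha>")
    case True
    then have "\<lfloor>s + \<alpha>\<rfloor> = \<lfloor>s\<rfloor>"
      using pos unfolding frac_def by linarith
    then show ?thesis
      using True by simp
  next
    case False
    then have "\<lfloor>s + \<alpha>\<rfloor> = \<lfloor>s\<rfloor> + 1"
      using less_1 unfolding frac_def by linarith
    then show ?thesis
      using False by simp
  qed
  also have "s + \<alpha> = x + real (Suc i) * \<alpha>"
    by (simp add: s_def algebra_simps)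
  finally show ?thesis
    by (simp add: s_def)
qed

lemma map_sturmian_coding:
  assumes "x \<in> {0..<1}"
  shows "map (sturmian_coding \<alpha> x) [k..<k + n] = W n (x + real k * \<alpha>)"
  using sturmian_coding_eq[OF assms]
  by (auto simp: nth_rotation_word algebra_simps intro!: nth_equalityI)

lemma sturmian_coding_in_subshift:
  assumes "x \<in> {0..<1}"
  shows "sturmian_coding \<alpha> x \<in> sturmian_subshift \<alpha>"
proof -
  have "sturmian_coding \<alpha> ` {0..<1}
      \<subseteq> topspace (product_topology (\<lambda>i::nat. discrete_topology {0, 1::nat}) UNIV)"
    by (auto simp: sturmian_coding_def)
  from closure_of_subset[OF this] assms show ?thesis
    unfolding sturmian_subshift_def by blast
qed

lemma sturmian_subshift_approx:
  assumes "z \<in> sturmian_subshift \<alpha>"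
  obtains x where "x \<in> {0..<1}" "\<And>i. i < n \<Longrightarrow> z i = sturmian_coding \<alpha> x i"
proof -
  let ?X = "product_topology (\<lambda>i::nat. discrete_topology {0, 1::nat}) UNIV"
  let ?U = "\<lambda>i. if i < n then {z i} else {0, 1}"
  have z: "z i \<in> {0, 1}" for i
    using assms unfolding sturmian_subshift_def in_closure_of by auto
  \<comment> \<open>Only the first \<open>n\<close> factors are restricted, so this cylinder around
    \<open>z\<close> is open and, \<open>z\<close> lying in the closure, meets the image of the
    coding.\<close>
  have "finite {i \<in> UNIV. ?U i \<noteq> topspace (discrete_topology {0, 1})}"
    by (rule finite_subset[of _ "{..<n}"]) auto
  then have "openin ?X (PiE UNIV ?U)"
    unfolding openin_PiE_gen using z by auto
  moreover have "z \<in> PiE UNIV ?U"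
    using z by auto
  ultimately obtain w where w: "w \<in> sturmian_coding \<alpha> ` {0..<1}" "w \<in> PiE UNIV ?U"
    using assms unfolding sturmian_subshift_def in_closure_of by blast
  then obtain x where x: "x \<in> {0..<1}" "w = sturmian_coding \<alpha> x"
    by blast
  have "z i = sturmian_coding \<alpha> x i" if "i < n" for i
    using PiE_mem[OF w(2), of i] that x(2) by simp
  with x(1) that show thesis
    by blast
qed

lemma rotation_word_frac:
  "W n t = map (sturmian_coding \<alpha> (frac t)) [0..<n]"
proof -
  have "W n t = W n (frac t + of_int \<lfloor>t\<rfloor>)"
    by (simp add: frac_def)
  also have "\<dots> = W n (frac t)"
    by (rule rotation_word_add_int)
  also have "\<dots> = map (sturmian_coding \<alpha> (frac t)) [0..<n]"
    using map_sturmian_coding[of "frac t" 0 n] by (simp add: frac_lt_1)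
  finally show ?thesis .
qed

lemma frac_in_unit: "frac (t::real) \<in> {0..<1}"
  by (simp add: frac_lt_1)

text \<open>A word involves finitely many coordinates, so the closure adds no words. Conversely, the
  word at any real \<open>t\<close> is a prefix of the coding of \<open>frac t\<close>.\<close>

lemma language_sturmian: "language n (sturmian_subshift \<alpha>) = range (W n)"
proof (intro equalityI subsetI)
  fix u assume "u \<in> language n (sturmian_subshift \<alpha>)"
  then obtain z k where z: "z \<in> sturmian_subshift \<alpha>" and u: "u = map z [k..<k + n]"
    by (auto simp: language_def)
  obtain x where x: "x \<in> {0..<1}" "\<And>i. i < k + n \<Longrightarrow> z i = sturmian_coding \<alpha> x i"
    using sturmian_subshift_approx[OF z, of "k + n"] by blast
  have "u = map (sturmian_coding \<alpha> x) [k..<k + n]"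
    using x(2) u by auto
  then show "u \<in> range (W n)"
    using map_sturmian_coding[OF x(1)] by simp
next
  fix u assume "u \<in> range (W n)"
  then obtain t where "u = map (sturmian_coding \<alpha> (frac t)) [0..<0 + n]"
    using rotation_word_frac by auto
  then show "u \<in> language n (sturmian_subshift \<alpha>)"
    unfolding language_def using sturmian_coding_in_subshift[OF frac_in_unit] by blast
qed

lemma block_code_rotation_word:
  assumes "1 \<le> n"
  shows "block_code m \<psi> n (W (m + n - 1) t) = map (\<lambda>i. \<psi> (W m (t + real i * \<alpha>))) [0..<n]"
  unfolding block_code_def by (auto simp: slice_rotation_word)

section \<open>Diophantine gaps and uniform density of the orbit\<close>

text \<open>No positive multiple of \<alpha> is an integer, and finitely many positive distances to
  the nearest integer have a positive minimum. This keeps cut points with distinct nearby indices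
  apart modulo 1.\<close>

lemma multiples_bounded_away:
  "\<exists>\<delta>>0. \<forall>j\<in>{1..M}. \<forall>q::int. \<delta> \<le> \<bar>real j * \<alpha> - of_int q\<bar>"
proof (induction M)
  case (Suc M)
  then obtain \<delta> where \<delta>: "\<delta> > 0" "\<forall>j\<in>{1..M}. \<forall>q::int. \<delta> \<le> \<bar>real j * \<alpha> - of_int q\<bar>"
    by blast
  define r where "r = real (Suc M) * \<alpha>"
  have "r \<notin> \<rat>"
  proof
    assume "r \<in> \<rat>"
    then have "r / real (Suc M) \<in> \<rat>"
      by (intro Rats_divide) auto
    then show False
      using irrational by (simp add: r_def del: of_nat_Suc)
  qed
  then have "r \<noteq> of_int (round r)"
    by (metis Rats_of_int)
  then have "0 < \<bar>r - of_int (round r)\<bar>"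
    by simp
  moreover have "\<bar>r - of_int (round r)\<bar> \<le> \<bar>r - of_int q\<bar>" for q
    by (rule round_diff_minimal)
  ultimately show ?case
    using \<delta> by (intro exI[of _ "min \<delta> \<bar>r - of_int (round r)\<bar>"])
      (auto simp: atLeastAtMostSuc_conv r_def min_le_iff_disj)
qed (auto intro: exI[of _ 1])

text \<open>Density supplies an index for each target; restricting the targets to a finite grid lets
  one bound \<open>N\<close> serve all reals \<open>c\<close>.\<close>

lemma orbit_uniformly_dense:
  assumes "0 < \<epsilon>"
  obtains N where "\<And>c::real. \<exists>i<N. \<exists>p::int. \<bar>real i * \<alpha> - of_int p - c\<bar> < \<epsilon>"
proof -
  obtain M :: nat where M: "M > 0" "1 / real M < \<epsilon> / 2"
    using reals_Archimedean[of "\<epsilon> / 2"] assms by (auto simp: inverse_eq_divide intro: that[OF zero_less_Suc])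
  have "\<exists>i p. \<bar>real i * \<alpha> - of_int p - c\<bar> < \<epsilon> / 2" for c :: real
  proof -
    obtain h k :: int where "k > 0" "\<bar>of_int k * \<alpha> - of_int h - c\<bar> < \<epsilon> / 2"
      using sequence_of_fractional_parts_is_dense[OF irrational half_gt_zero[OF assms], of c] by metis
    then show ?thesis
      by (intro exI[of _ "nat k"] exI[of _ h]) simp
  qed
  then obtain I where I: "\<exists>p. \<bar>real (I c) * \<alpha> - of_int p - c\<bar> < \<epsilon> / 2" for c :: real
    by metis
  define N where "N = Suc (Max ((\<lambda>j. I (real j / real M)) ` {..M}))"
  have "\<exists>i<N. \<exists>p::int. \<bar>real i * \<alpha> - of_int p - c\<bar> < \<epsilon>" for c :: real
  proof -
    \<comment> \<open>\<open>j / M\<close> is the grid point at or just below \<open>frac c\<close>;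
      the integer part of \<open>c\<close> is absorbed into \<open>p\<close> at the end.\<close>
    define j where "j = nat \<lfloor>frac c * real M\<rfloor>"
    have "real j = of_int \<lfloor>frac c * real M\<rfloor>"
      by (simp add: j_def)
    then have j: "real j \<le> frac c * real M" "frac c * real M < real j + 1"
      by linarith+
    then have "real j / real M \<le> frac c" "frac c < (real j + 1) / real M"
      using M(1) by (simp_all add: field_simps)
    then have close: "\<bar>real j / real M - frac c\<bar> < \<epsilon> / 2"
      using M(2) by (simp add: add_divide_distrib)
    have "frac c * real M \<le> 1 * real M"
      using frac_lt_1[of c] by (intro mult_right_mono) auto
    then have "real j \<le> real M"
      using j(1) by linarith
    then have "j \<in> {..M}"
      by simp
    then have "I (real j / real M) < N"
      unfolding N_def less_Suc_eq_le by (intro Max_ge) auto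
    moreover obtain p where p: "\<bar>real (I (real j / real M)) * \<alpha> - of_int p - real j / real M\<bar> < \<epsilon> / 2"
      using I by blast
    have "\<bar>real (I (real j / real M)) * \<alpha> - of_int (p - \<lfloor>c\<rfloor>) - c\<bar> < \<epsilon>"
      using p close unfolding frac_def abs_less_iff of_int_diff by linarith
    ultimately show ?thesis
      by blast
  qed
  with that show thesis
    by blast
qed

section \<open>Isolated cut points and the jumps of the rule\<close>

text \<open>A second cut point between \<open>s\<close> and \<open>t\<close>, of index
  \<open>j \<noteq> k\<close>, would put a multiple of \<alpha> by at most \<open>m\<close> closer
  than \<delta> to an integer.\<close>

lemma straddle_if_close:
  assumes gap: "\<And>j q::int. j \<in> {1..m} \<Longrightarrow> \<delta> \<le> \<bar>real j * \<alpha> - of_int q\<bar>" and "1 \<le> m"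
    and "k \<le> m" and q: "s + real k * \<alpha> < of_int q" "of_int q \<le> t + real k * \<alpha>"
    and "t - s < \<delta>"
  shows "straddle \<alpha> m k s t"
proof -
  have same: "\<lfloor>s + real j * \<alpha>\<rfloor> = \<lfloor>t + real j * \<alpha>\<rfloor>" if "j \<le> m" "j \<noteq> k" for j
  proof (rule ccontr)
    assume *: "\<lfloor>s + real j * \<alpha>\<rfloor> \<noteq> \<lfloor>t + real j * \<alpha>\<rfloor>"
    obtain p :: int where p: "s + real j * \<alpha> < of_int p" "of_int p \<le> t + real j * \<alpha>"
      by (rule floor_neq_imp_int_between[OF _ *]) (use q in auto)
    show False
    proof (cases "j < k")
      case True
      then have "\<delta> \<le> \<bar>real (k - j) * \<alpha> - of_int (q - p)\<bar>"
        using \<open>k \<le> m\<close> by (intro gap) auto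
      moreover have "real (k - j) * \<alpha> = real k * \<alpha> - real j * \<alpha>"
        using True by (simp add: of_nat_diff algebra_simps)
      ultimately show False
        using p q assms(6) by simp
    next
      case False
      then have "\<delta> \<le> \<bar>real (j - k) * \<alpha> - of_int (p - q)\<bar>"
        using that by (intro gap) auto
      moreover have "real (j - k) * \<alpha> = real j * \<alpha> - real k * \<alpha>"
        using False by (simp add: of_nat_diff algebra_simps)
      ultimately show False
        using p q assms(6) by simp
    qed
  qed
  \<comment> \<open>With \<delta> at most 1 the interval cannot contain two integer translates of
    one cut point, so the floor at \<open>k\<close> rises by exactly 1.\<close>
  have "\<delta> \<le> \<bar>real 1 * \<alpha> - of_int 0\<bar>" "\<delta> \<le> \<bar>real 1 * \<alpha> - of_int 1\<bar>"
    using \<open>1 \<le> m\<close> by (intro gap; simp)+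
  then have "\<delta> \<le> 1"
    using pos less_1 by simp
  then have "of_int q - 1 \<le> s + real k * \<alpha>" "t + real k * \<alpha> < of_int q + 1"
    using q assms(6) by auto
  then have "\<lfloor>s + real k * \<alpha>\<rfloor> = q - 1" "\<lfloor>t + real k * \<alpha>\<rfloor> = q"
    using q by (auto simp: floor_eq_iff)
  with same show ?thesis
    by (simp add: straddle_def)
qed

text \<open>If equal tails forced equal values, the rule would factor through the tail and ignore
  the first letter. After an integer shift, equal tails fix every floor but the one at index 0, so
  the difference in value arises there.\<close>

lemma ex_jump_first:
  assumes "1 \<le> m" and "local_rule m (sturmian_subshift \<alpha>) \<Delta> \<psi>"
    and "\<not> ignores_first_letter m (sturmian_subshift \<alpha>) \<Delta> \<psi>"
  obtains s t where "straddle \<alpha> m 0 s t" "\<psi> (W m s) \<noteq> \<psi> (W m t)"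
proof -
  have "\<exists>x y. slice (W m x) 1 m = slice (W m y) 1 m \<and> \<psi> (W m x) \<noteq> \<psi> (W m y)"
  proof (rule ccontr)
    assume "\<nexists>x y. slice (W m x) 1 m = slice (W m y) 1 m \<and> \<psi> (W m x) \<noteq> \<psi> (W m y)"
    then have same: "\<psi> (W m x) = \<psi> (W m y)" if "slice (W m x) 1 m = slice (W m y) 1 m" for x y
      using that by blast
    define \<psi>' where "\<psi>' w = \<psi> (W m (SOME x. slice (W m x) 1 m = w))" for w
    have \<psi>': "\<psi>' (slice (W m x) 1 m) = \<psi> (W m x)" for x
      unfolding \<psi>'_def by (rule same, rule someI[of _ x]) simp
    \<comment> \<open>Each word of length \<open>m - 1\<close> is a tail, as the starting point can
      move back by \<alpha>; so \<open>\<psi>'\<close> maps the whole shorter language into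
      \<Delta>.\<close>
    have "slice (W m (t - \<alpha>)) 1 m = W (m - 1) t" for t
      using \<open>1 \<le> m\<close> by (simp add: slice_rotation_word)
    then have "\<psi>' (W (m - 1) t) = \<psi> (W m (t - \<alpha>))" for t
      using \<psi>' by metis
    then have "local_rule (m - 1) (sturmian_subshift \<alpha>) \<Delta> \<psi>'"
      using assms(2) by (auto simp: local_rule_def language_sturmian)
    with \<psi>' assms(3) show False
      by (auto simp: ignores_first_letter_def language_sturmian)
  qed
  then obtain x' y' where tails: "slice (W m x') 1 m = slice (W m y') 1 m"
    and ne': "\<psi> (W m x') \<noteq> \<psi> (W m y')"
    by blast
  define x y where "x = x' + of_int (- \<lfloor>x' + \<alpha>\<rfloor>)" and "y = y' + of_int (- \<lfloor>y' + \<alpha>\<rfloor>)"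
  have W: "W n x = W n x'" "W n y = W n y'" for n
    by (simp_all only: x_def y_def rotation_word_add_int)
  have fl1: "\<lfloor>x + \<alpha>\<rfloor> = 0" "\<lfloor>y + \<alpha>\<rfloor> = 0"
    unfolding x_def y_def by linarith+
  have ne: "\<psi> (W m x) \<noteq> \<psi> (W m y)"
    using ne' by (simp add: W)
  have "slice (W m x) 1 m = slice (W m y) 1 m"
    using tails by (simp add: W)
  then have "W (m - 1) (x + \<alpha>) = W (m - 1) (y + \<alpha>)"
    using \<open>1 \<le> m\<close> by (simp add: slice_rotation_word)
  note rotation_word_eq_imp_floors[OF this]
  then have "\<lfloor>x + \<alpha> + real (j - 1) * \<alpha>\<rfloor> = \<lfloor>y + \<alpha> + real (j - 1) * \<alpha>\<rfloor>" if "j \<le> m" for j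
    using that fl1 by simp
  moreover have "\<alpha> + real (j - 1) * \<alpha> = real j * \<alpha>" if "j \<noteq> 0" for j
    using that by (simp add: of_nat_diff algebra_simps)
  ultimately have fl: "\<lfloor>x + real j * \<alpha>\<rfloor> = \<lfloor>y + real j * \<alpha>\<rfloor>" if "j \<le> m" "j \<noteq> 0" for j
    using that by (metis add.assoc)
  have "\<lfloor>x\<rfloor> \<noteq> \<lfloor>y\<rfloor>"
  proof
    assume eq: "\<lfloor>x\<rfloor> = \<lfloor>y\<rfloor>"
    have "\<lfloor>x + real j * \<alpha>\<rfloor> = \<lfloor>y + real j * \<alpha>\<rfloor>" if "j \<le> m" for j
      using fl that eq by (cases "j = 0") auto
    from rotation_word_cong[OF this] ne show False
      by simp
  qed
  moreover have "\<lfloor>x\<rfloor> \<in> {-1, 0}" "\<lfloor>y\<rfloor> \<in> {-1, 0}"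
    using fl1 pos less_1 by (simp; linarith)+
  ultimately have "straddle \<alpha> m 0 x y \<or> straddle \<alpha> m 0 y x"
    using fl by (auto simp: straddle_def)
  with ne that show thesis
    by metis
qed

text \<open>For \<open>m \<noteq> 1\<close>, a rule determined by heads contradicts minimality.
  Equal heads leave only the floor at index \<open>m\<close> free.\<close>

lemma ex_jump_last:
  assumes "1 \<le> m" and "local_rule m (sturmian_subshift \<alpha>) \<Delta> \<psi>"
    and "minimal_rule m (sturmian_subshift \<alpha>) \<Delta> \<psi>"
    and "\<not> ignores_first_letter m (sturmian_subshift \<alpha>) \<Delta> \<psi>"
  obtains s t where "straddle \<alpha> m m s t" "\<psi> (W m s) \<noteq> \<psi> (W m t)"
proof -
  have "\<exists>x y. slice (W m x) 0 (m - 1) = slice (W m y) 0 (m - 1) \<and> \<psi> (W m x) \<noteq> \<psi> (W m y)"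
  proof (cases "m = 1")
    case True
    \<comment> \<open>For \<open>m = 1\<close> all heads are empty, so the two words given by the
      first-letter hypothesis agree on them.\<close>
    obtain s t where "straddle \<alpha> m 0 s t" "\<psi> (W m s) \<noteq> \<psi> (W m t)"
      using ex_jump_first[OF assms(1,2,4)] by blast
    then show ?thesis
      using True by (auto simp: slice_def)
  next
    case False
    show ?thesis
    proof (rule ccontr)
      assume "\<nexists>x y. slice (W m x) 0 (m - 1) = slice (W m y) 0 (m - 1) \<and> \<psi> (W m x) \<noteq> \<psi> (W m y)"
      then have same: "\<psi> (W m x) = \<psi> (W m y)"
        if "slice (W m x) 0 (m - 1) = slice (W m y) 0 (m - 1)" for x y
        using that by blast
      define \<psi>' where "\<psi>' w = \<psi> (W m (SOME x. slice (W m x) 0 (m - 1) = w))" for w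
      have \<psi>': "\<psi>' (slice (W m x) 0 (m - 1)) = \<psi> (W m x)" for x
        unfolding \<psi>'_def by (rule same, rule someI[of _ x]) simp
      have "slice (W m t) 0 (m - 1) = W (m - 1) t" for t
        by (simp add: slice_rotation_word)
      then have "\<psi>' (W (m - 1) t) = \<psi> (W m t)" for t
        using \<psi>' by metis
      then have "local_rule (m - 1) (sturmian_subshift \<alpha>) \<Delta> \<psi>'"
        using assms(2) by (auto simp: local_rule_def language_sturmian)
      with \<psi>' assms(3) False show False
        by (auto simp: minimal_rule_def language_sturmian)
    qed
  qed
  then obtain x' y' where heads: "slice (W m x') 0 (m - 1) = slice (W m y') 0 (m - 1)"
    and ne': "\<psi> (W m x') \<noteq> \<psi> (W m y')"
    by blast
  define x y where "x = x' + of_int (- \<lfloor>x'\<rfloor>)" and "y = y' + of_int (- \<lfloor>y'\<rfloor>)"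
  have W: "W n x = W n x'" "W n y = W n y'" for n
    by (simp_all only: x_def y_def rotation_word_add_int)
  have fl0: "\<lfloor>x\<rfloor> = 0" "\<lfloor>y\<rfloor> = 0"
    unfolding x_def y_def by linarith+
  have ne: "\<psi> (W m x) \<noteq> \<psi> (W m y)"
    using ne' by (simp add: W)
  have "W (m - 1) x = W (m - 1) y"
    using heads by (simp add: W slice_rotation_word)
  note rotation_word_eq_imp_floors[OF this]
  then have fl: "\<lfloor>x + real j * \<alpha>\<rfloor> = \<lfloor>y + real j * \<alpha>\<rfloor>" if "j \<le> m" "j \<noteq> m" for j
    using that fl0 by simp
  have "\<lfloor>x + real m * \<alpha>\<rfloor> \<noteq> \<lfloor>y + real m * \<alpha>\<rfloor>"
  proof
    assume eq: "\<lfloor>x + real m * \<alpha>\<rfloor> = \<lfloor>y + real m * \<alpha>\<rfloor>"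
    have "\<lfloor>x + real j * \<alpha>\<rfloor> = \<lfloor>y + real j * \<alpha>\<rfloor>" if "j \<le> m" for j
      using fl that eq by (cases "j = m") auto
    from rotation_word_cong[OF this] ne show False
      by simp
  qed
  moreover have "\<lfloor>x + real (m - 1) * \<alpha>\<rfloor> = \<lfloor>y + real (m - 1) * \<alpha>\<rfloor>"
    using fl[of "m - 1"] \<open>1 \<le> m\<close> by simp
  moreover have "\<lfloor>z + real m * \<alpha>\<rfloor> - \<lfloor>z + real (m - 1) * \<alpha>\<rfloor> \<in> {0, 1}" for z
    using floor_step[of z "m - 1"] \<open>1 \<le> m\<close> by simp
  from this[of x] this[of y]
  have "\<lfloor>x + real m * \<alpha>\<rfloor> - \<lfloor>x + real (m - 1) * \<alpha>\<rfloor> \<in> {0, 1}"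
    "\<lfloor>y + real m * \<alpha>\<rfloor> - \<lfloor>y + real (m - 1) * \<alpha>\<rfloor> \<in> {0, 1}" .
  ultimately have "straddle \<alpha> m m x y \<or> straddle \<alpha> m m y x"
    using fl by (auto simp: straddle_def)
  with ne that show thesis
    by metis
qed

section \<open>Separation of orbits by finitely many values\<close>

text \<open>Applied to \<open>f t = \<psi> (W m t)\<close>. Two uses of \<open>transport\<close>
  show that \<open>x\<close> and \<open>y\<close> are close modulo 1; \<open>close\<close> then
  gives equal words.\<close>

lemma orbit_separation:
  fixes f :: "real \<Rightarrow> 'd"
  assumes "1 \<le> m"
    and f_cong: "\<And>s t. W m s = W m t \<Longrightarrow> f s = f t"
    and jump: "\<And>s t k. straddle \<alpha> m k s t \<Longrightarrow> k \<in> {0, m} \<Longrightarrow> f s \<noteq> f t"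
  obtains n where "1 \<le> n"
    "\<And>x y. (\<And>i. i < n \<Longrightarrow> f (x + real i * \<alpha>) = f (y + real i * \<alpha>))
      \<Longrightarrow> W (m + n - 1) x = W (m + n - 1) y"
proof -
  obtain \<delta> where \<delta>: "\<delta> > 0"
    and gap: "\<And>j q::int. j \<in> {1..2 * m} \<Longrightarrow> \<delta> \<le> \<bar>real j * \<alpha> - of_int q\<bar>"
    using multiples_bounded_away[of "2 * m"] by blast
  have jump_close: "f s \<noteq> f t"
    if "k \<in> {0, m}" "s + real k * \<alpha> < of_int q" "of_int q \<le> t + real k * \<alpha>" "t - s < \<delta>" for s t k q
    using that assms(1) by (intro jump[of k] straddle_if_close[of m \<delta> k s q t] gap) auto
  have f_int: "f (t + of_int p) = f t" for t p
    by (rule f_cong) (rule rotation_word_add_int)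
  obtain N where N: "\<And>c::real. \<exists>i<N. \<exists>p::int. \<bar>real i * \<alpha> - of_int p - c\<bar> < \<delta> / 4"
    using orbit_uniformly_dense[of "\<delta> / 4"] \<delta> by auto
  \<comment> \<open>The first \<open>N\<close> times bring the orbit near any target; the extra
    \<open>m\<close> gives \<open>m \<le> n\<close>, so cut indices from \<open>n\<close> on can be
    shifted down by \<open>m\<close>.\<close>
  define n where "n = N + m"
  have n: "1 \<le> n" "N \<le> n" "m \<le> n"
    using assms(1) by (auto simp: n_def)
  \<comment> \<open>A cut index \<open>k\<close> below \<open>n\<close> becomes index 0 at time
    \<open>k\<close>; one from \<open>n\<close> to \<open>m + n - 1\<close> becomes index
    \<open>m\<close> at time \<open>k - m\<close>. Either way \<open>f\<close> jumps.\<close>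
  have close: "W (m + n - 1) x = W (m + n - 1) y"
    if "x \<le> y" "y - x < \<delta>" and same: "\<And>i. i < n \<Longrightarrow> f (x + real i * \<alpha>) = f (y + real i * \<alpha>)" for x y
  proof (rule ccontr)
    assume "W (m + n - 1) x \<noteq> W (m + n - 1) y"
    then obtain k q where k: "k \<le> m + n - 1"
      and q: "x + real k * \<alpha> < of_int q" "of_int q \<le> y + real k * \<alpha>"
      using rotation_word_neq_imp_cut[OF \<open>x \<le> y\<close>] by metis
    show False
    proof (cases "k < n")
      case True
      have "f (x + real k * \<alpha>) \<noteq> f (y + real k * \<alpha>)"
        by (rule jump_close[of 0 _ q]) (use q that in auto)
      with same[OF True] show False
        by simp
    next
      case False
      then have "real (k - m) * \<alpha> + real m * \<alpha> = real k * \<alpha>"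
        using n by (simp add: of_nat_diff algebra_simps)
      then have "f (x + real (k - m) * \<alpha>) \<noteq> f (y + real (k - m) * \<alpha>)"
        by (intro jump_close[of m _ q]) (use q that in auto)
      moreover have "k - m < n"
        using k n by simp
      ultimately show False
        using same by blast
    qed
  qed
  \<comment> \<open>Two points of the orbit of \<open>x\<close> modulo 1 on either side of
    \<open>- k0 * \<alpha>\<close> have distinct values. Translation by \<open>y - x\<close> keeps
    these values, so a cut point also separates the translates.\<close>
  have transport: "\<exists>k\<le>m. \<exists>q::int. \<bar>y - x - real k0 * \<alpha> + real k * \<alpha> - of_int q\<bar> < \<delta> / 2"
    if "k0 \<in> {0, m}" and same: "\<And>i. i < n \<Longrightarrow> f (x + real i * \<alpha>) = f (y + real i * \<alpha>)" for x y k0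
  proof -
    \<comment> \<open>Targets at \<open>\<delta> / 4\<close> left and right of the cut point, met
      with error below \<open>\<delta> / 4\<close>, land strictly on either side within
      \<open>\<delta> / 2\<close>.\<close>
    obtain i p where i: "i < N" "\<bar>real i * \<alpha> - of_int p - (- x - real k0 * \<alpha> - \<delta> / 4)\<bar> < \<delta> / 4"
      using N by blast
    obtain j r where j: "j < N" "\<bar>real j * \<alpha> - of_int r - (- x - real k0 * \<alpha> + \<delta> / 4)\<bar> < \<delta> / 4"
      using N by blast
    define s t where "s = x + real i * \<alpha> + of_int (- p)" and "t = x + real j * \<alpha> + of_int (- r)"
    have s: "- \<delta> / 2 < s + real k0 * \<alpha>" "s + real k0 * \<alpha> < 0"
      using i(2) unfolding s_def by (simp_all add: abs_less_iff; linarith)+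
    have t: "0 < t + real k0 * \<alpha>" "t + real k0 * \<alpha> < \<delta> / 2"
      using j(2) unfolding t_def by (simp_all add: abs_less_iff; linarith)+
    have "f s \<noteq> f t"
      by (rule jump_close[of k0 s 0 t]) (use that s t in auto)
    moreover have "f s = f (s + (y - x))"
      using same[of i] i(1) n(2) f_int[of "x + real i * \<alpha>" "- p"] f_int[of "y + real i * \<alpha>" "- p"]
      by (simp add: s_def algebra_simps)
    moreover have "f t = f (t + (y - x))"
      using same[of j] j(1) n(2) f_int[of "x + real j * \<alpha>" "- r"] f_int[of "y + real j * \<alpha>" "- r"]
      by (simp add: t_def algebra_simps)
    ultimately have "W m (s + (y - x)) \<noteq> W m (t + (y - x))"
      using f_cong by metis
    then obtain k q where k: "k \<le> m" "s + (y - x) + real k * \<alpha> < of_int q"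
        "of_int q \<le> t + (y - x) + real k * \<alpha>"
      using rotation_word_neq_imp_cut[of "s + (y - x)" "t + (y - x)"] s t by (smt (verit))
    then have "\<bar>y - x - real k0 * \<alpha> + real k * \<alpha> - of_int q\<bar> < \<delta> / 2"
      using s t by linarith
    with k(1) show ?thesis
      by blast
  qed
  have "W (m + n - 1) x = W (m + n - 1) y"
    if same: "\<And>i. i < n \<Longrightarrow> f (x + real i * \<alpha>) = f (y + real i * \<alpha>)" for x y
  proof -
    obtain k q where k: "k \<le> m" "\<bar>y - x - real 0 * \<alpha> + real k * \<alpha> - of_int q\<bar> < \<delta> / 2"
      using transport[of 0 x y] same by auto
    obtain l p where l: "l \<le> m" "\<bar>y - x - real m * \<alpha> + real l * \<alpha> - of_int p\<bar> < \<delta> / 2"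
      using transport[of m x y] same by auto
    \<comment> \<open>Subtracting the two estimates of \<open>y - x\<close> puts this multiple
      within \<delta> of an integer; among indices up to \<open>2 * m\<close> only 0 allows
      that.\<close>
    have "real (k + (m - l)) * \<alpha> = real k * \<alpha> + (real m * \<alpha> - real l * \<alpha>)"
      using l(1) by (simp add: of_nat_diff algebra_simps)
    then have "\<bar>real (k + (m - l)) * \<alpha> - of_int (q - p)\<bar> < \<delta>"
      using k(2) l(2) unfolding abs_less_iff of_int_diff by linarith
    then have "k + (m - l) \<notin> {1..2 * m}"
      using gap[of "k + (m - l)" "q - p"] by linarith
    then have "k = 0"
      using k(1) by auto
    \<comment> \<open>With \<open>k = 0\<close>, \<open>y - x\<close> is near the integer
      \<open>q\<close>; the translate \<open>z\<close> of \<open>y\<close> is near \<open>x\<close>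
      itself, with the same values of \<open>f\<close> and the same words.\<close>
    define z where "z = y + of_int (- q)"
    have "z - x = y - x - real 0 * \<alpha> + real k * \<alpha> - of_int q"
      by (simp add: z_def \<open>k = 0\<close>)
    then have "\<bar>z - x\<bar> < \<delta> / 2"
      using k(2) by (simp only:)
    then have dist: "\<bar>z - x\<bar> < \<delta>"
      using \<delta> by simp
    have same_z: "f (x + real i * \<alpha>) = f (z + real i * \<alpha>)" if "i < n" for i
      using same[OF that] f_int[of "y + real i * \<alpha>" "- q"] by (simp add: z_def algebra_simps)
    have "W (m + n - 1) x = W (m + n - 1) z"
    proof (cases "x \<le> z")
      case True
      show ?thesis
        by (rule close) (use True dist same_z in auto)
    next
      case False
      have "W (m + n - 1) z = W (m + n - 1) x"
        by (rule close) (use False dist same_z in auto)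
      then show ?thesis ..
    qed
    then show ?thesis
      unfolding z_def rotation_word_add_int .
  qed
  with n(1) that show thesis
    by blast
qed

end

section \<open>Injectivity of the codes and the equivalence\<close>

theorem proposition19:
  fixes \<alpha> :: real and \<Gamma> :: "(nat \<Rightarrow> nat) set"
    and \<Delta> :: "'d set" and m :: nat and \<psi> :: "nat list \<Rightarrow> 'd"
  assumes "0 < \<alpha>" and "\<alpha> < 1" and "\<alpha> \<notin> \<rat>"
    and "\<Gamma> = sturmian_subshift \<alpha>"
    and "finite \<Delta>"
    and "1 \<le> m"
    and "local_rule m \<Gamma> \<Delta> \<psi>"
    and "minimal_rule m \<Gamma> \<Delta> \<psi>"
    and "\<not> ignores_first_letter m \<Gamma> \<Delta> \<psi>"
  shows "((\<exists>n\<ge>1. inj_on (block_code m \<psi> n) (language (m + n - 1) \<Gamma>))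
            \<longleftrightarrow> inj_on (infinite_block_code m \<psi>) \<Gamma>) \<and>
         (inj_on (infinite_block_code m \<psi>) \<Gamma>
            \<longleftrightarrow> \<not> infinite_block_code m \<psi> constant_on \<Gamma>) \<and>
         (\<not> infinite_block_code m \<psi> constant_on \<Gamma>
            \<longleftrightarrow> \<not> \<psi> constant_on language m \<Gamma>)"
proof -
  interpret irrational_rotation \<alpha>
    using assms(1-3) by unfold_locales
  note \<Gamma> = \<open>\<Gamma> = sturmian_subshift \<alpha>\<close>
  note rule = assms(6-9)[unfolded \<Gamma>]
  have lang: "language n \<Gamma> = range (W n)" for n
    unfolding \<Gamma> by (rule language_sturmian)
  obtain s0 t0 where first: "straddle \<alpha> m 0 s0 t0" "\<psi> (W m s0) \<noteq> \<psi> (W m t0)"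
    using ex_jump_first[OF rule(1,2,4)] by blast
  obtain s1 t1 where last: "straddle \<alpha> m m s1 t1" "\<psi> (W m s1) \<noteq> \<psi> (W m t1)"
    using ex_jump_last[OF rule] by blast
  have jump: "\<psi> (W m s) \<noteq> \<psi> (W m t)" if st: "straddle \<alpha> m k s t" and k: "k \<in> {0, m}" for s t k
  proof (cases "k = 0")
    case True
    then show ?thesis
      using first straddle_rotation_word[OF first(1), of s t] st by simp
  next
    case False
    then show ?thesis
      using last straddle_rotation_word[OF last(1), of s t] st k by simp
  qed
  obtain n where n: "1 \<le> n"
    "\<And>x y. (\<And>i. i < n \<Longrightarrow> \<psi> (W m (x + real i * \<alpha>)) = \<psi> (W m (y + real i * \<alpha>)))
      \<Longrightarrow> W (m + n - 1) x = W (m + n - 1) y"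
    using orbit_separation[of m "\<lambda>t. \<psi> (W m t)"] \<open>1 \<le> m\<close> jump by metis
  have inj_block: "inj_on (block_code m \<psi> n) (language (m + n - 1) \<Gamma>)"
  proof (rule inj_onI)
    fix u v assume "u \<in> language (m + n - 1) \<Gamma>" "v \<in> language (m + n - 1) \<Gamma>"
      and eq: "block_code m \<psi> n u = block_code m \<psi> n v"
    then obtain x y where u: "u = W (m + n - 1) x" and v: "v = W (m + n - 1) y"
      unfolding lang by blast
    have "\<psi> (W m (x + real i * \<alpha>)) = \<psi> (W m (y + real i * \<alpha>))" if "i < n" for i
      using eq that unfolding u v block_code_rotation_word[OF n(1)] by auto
    then show "u = v"
      unfolding u v by (rule n(2))
  qed
  have inj_infinite: "inj_on (infinite_block_code m \<psi>) \<Gamma>"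
  proof (rule inj_onI)
    fix x y assume xy: "x \<in> \<Gamma>" "y \<in> \<Gamma>"
      and eq: "infinite_block_code m \<psi> x = infinite_block_code m \<psi> y"
    \<comment> \<open>The block code of the window of length \<open>m + n - 1\<close> at
      \<open>k\<close> consists of \<open>n\<close> coordinates of the infinite image, so
      \<open>inj_block\<close> recovers the window, which contains position
      \<open>k\<close>.\<close>
    have "x k = y k" for k
    proof -
      let ?w = "\<lambda>z. map z [k..<k + (m + n - 1)]"
      have code: "block_code m \<psi> n (?w z) = map (\<lambda>i. infinite_block_code m \<psi> z (k + i)) [0..<n]" for z
      proof -
        have "slice (?w z) i (i + m) = map z [k + i..<k + i + m]" if "i < n" for i
          using that by (auto simp: slice_def add.assoc intro!: nth_equalityI)
        then show ?thesis
          by (auto simp: block_code_def infinite_block_code_def)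
      qed
      have "?w x \<in> language (m + n - 1) \<Gamma>" "?w y \<in> language (m + n - 1) \<Gamma>"
        unfolding language_def using xy by blast+
      then have "?w x = ?w y"
        using inj_block code eq by (metis inj_onD)
      moreover have "k \<in> set [k..<k + (m + n - 1)]"
        using \<open>1 \<le> m\<close> n(1) by auto
      ultimately show ?thesis
        unfolding map_eq_conv by blast
    qed
    then show "x = y"
      by (rule ext)
  qed
  have rule_not_constant: "\<not> \<psi> constant_on language m \<Gamma>"
    using first(2) unfolding constant_on_def lang by (metis rangeI)
  have not_constant: "\<not> infinite_block_code m \<psi> constant_on \<Gamma>"
  proof
    assume "infinite_block_code m \<psi> constant_on \<Gamma>"
    then obtain c where c: "\<And>x. x \<in> \<Gamma> \<Longrightarrow> infinite_block_code m \<psi> x = c"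
      unfolding constant_on_def by blast
    \<comment> \<open>Each \<open>W m t\<close> is a prefix of a coding in \<Gamma>, so its value is
      coordinate 0 of the constant image.\<close>
    have "\<psi> (W m t) = c 0" for t
      using c[of "sturmian_coding \<alpha> (frac t)"] sturmian_coding_in_subshift[OF frac_in_unit, of t]
      unfolding \<Gamma> rotation_word_frac infinite_block_code_def by auto
    then show False
      using first(2) by simp
  qed
  show ?thesis
    using inj_block inj_infinite rule_not_constant not_constant n(1) by blast
qed

end
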